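(* Fix integers $n\ge 1$ and $r\ge 1$. Let $P_n$ be the path on vertices $v_1,\dots,v_n$ with edges $v_iv_{i+1}$ ($1\le i\le n-1$), and let $G(n,r)$ be the graph obtained from $P_n$ by attaching $r$ pendant vertices $\ell_{i,1},\dots,\ell_{i,r}$ (each of degree one, adjacent only to $v_i$) to each $v_i$, $1\le i\le n$. Then $$\gamma(G(n,r))=n,\qquad \zeta(G(n,r))=\begin{cases}2^n,& r=1,\\ 1,& r\ge 2.\end{cases}$$ In particular, if $r\ge 2$ the unique minimum dominating set is $\{v_1,\dots,v_n\}$, whereas if $r=1$ the minimum dominating sets are exactly the sets obtained by choosing one vertex from each pair $\{v_i,\ell_{i,1}\}$, $1\le i\le n$, independently.
   Context: For a finite simple graph $G$, a set $D\subseteq V(G)$ is dominating if every vertex of $G$ lies in $D$ or has a neighbor in $D$. The domination number $\gamma(G)$ is the minimum size of a dominating set, and a minimum dominating set is a dominating set of size $\gamma(G)$. The dominion $\zeta(G)$ is the number of dominating sets of $G$ of size $\gamma(G)$. *)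

theory Defs
  imports "Graph_Theory.Pair_Digraph"
begin

text \<open>
  A finite simple graph is a \<^locale>\<open>pair_graph\<close>: a finite vertex set and a symmetric,
  irreflexive set of ordered pairs, so an undirected edge is represented by both of its
  orientations.
\<close>

definition dominating_set :: "'a pair_pre_digraph \<Rightarrow> 'a set \<Rightarrow> bool" where
  "dominating_set G D \<longleftrightarrow>
     D \<subseteq> pverts G \<and> (\<forall>v\<in>pverts G. v \<in> D \<or> (\<exists>u\<in>D. (v, u) \<in> parcs G))"

definition domination_number :: "'a pair_pre_digraph \<Rightarrow> nat" where
  "domination_number G = (LEAST k. \<exists>D. dominating_set G D \<and> card D = k)"

definition minimum_dominating_set :: "'a pair_pre_digraph \<Rightarrow> 'a set \<Rightarrow> bool" where
  "minimum_dominating_set G D \<longleftrightarrow> dominating_set G D \<and> card D = domination_number G"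

definition dominion :: "'a pair_pre_digraph \<Rightarrow> nat" where
  "dominion G = card {D. minimum_dominating_set G D}"

definition path_graph :: "nat \<Rightarrow> nat pair_pre_digraph" where
  "path_graph n =
     \<lparr> pverts = {1..n},
       parcs = {(i, Suc i) | i. 1 \<le> i \<and> i < n} \<union> {(Suc i, i) | i. 1 \<le> i \<and> i < n} \<rparr>"

datatype 'a pendant_vertex = Base 'a | Pendant 'a nat

definition attach_pendants :: "nat \<Rightarrow> 'a pair_pre_digraph \<Rightarrow> 'a pendant_vertex pair_pre_digraph" where
  "attach_pendants r G =
     \<lparr> pverts = Base ` pverts G \<union> {Pendant v j | v j. v \<in> pverts G \<and> j \<in> {1..r}},
       parcs = {(Base u, Base v) | u v. (u, v) \<in> parcs G}
         \<union> {(Base v, Pendant v j) | v j. v \<in> pverts G \<and> j \<in> {1..r}}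
         \<union> {(Pendant v j, Base v) | v j. v \<in> pverts G \<and> j \<in> {1..r}} \<rparr>"

lemma pair_graph_path_graph: "pair_graph (path_graph n)"
proof -
  have "finite (parcs (path_graph n))"
    by (rule finite_subset[of _ "{1..n} \<times> {1..n}"]) (auto simp: path_graph_def)
  then show ?thesis
    by unfold_locales (auto simp: path_graph_def symmetric_def arcs_ends_def arc_to_ends_def sym_def)
qed

lemma pair_graph_attach_pendants:
  assumes "pair_graph G"
  shows "pair_graph (attach_pendants r G)"
proof -
  interpret pair_graph G by (rule assms)
  have eq: "{Pendant v j | v j. v \<in> pverts G \<and> j \<in> {1..r}}
      = (\<lambda>(v, j). Pendant v j) ` (pverts G \<times> {1..r})" by auto
  have fv: "finite (pverts (attach_pendants r G))"
    unfolding attach_pendants_def eq by simp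
  have sub: "parcs (attach_pendants r G)
      \<subseteq> pverts (attach_pendants r G) \<times> pverts (attach_pendants r G)"
    by (auto simp: attach_pendants_def dest: in_arcsD1 in_arcsD2)
  have fa: "finite (parcs (attach_pendants r G))"
    using finite_subset[OF sub] fv by simp
  have sy: "(v, u) \<in> parcs G" if "(u, v) \<in> parcs G" for u v
    using that by (rule arcs_symmetric)
  have nl: "(u, u) \<notin> parcs G" for u
    using no_loops'[of u u] by auto
  show ?thesis
    using fv fa
    by unfold_locales
      (auto simp: attach_pendants_def symmetric_def arcs_ends_def arc_to_ends_def sym_def nl
            dest: sy in_arcsD1 in_arcsD2)
qed

lemma pendant_degree_one:
  assumes "v \<in> pverts G" and "j \<in> {1..r}"
  shows "{u. (Pendant v j, u) \<in> parcs (attach_pendants r G)} = {Base v}"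
  using assms by (auto simp: attach_pendants_def)

end

theory Submission
  imports Defs
begin

text \<open>
  A pendant vertex can only be dominated by itself or by its base vertex. So a dominating set
  meets the fibre over every base vertex, which gives the lower bound on its size, and it is
  minimum iff it meets each fibre exactly once. With two or more pendants at a vertex a single
  element of the fibre can only be the base vertex; with one pendant either element will do.
\<close>

section \<open>Dominating sets in the presence of pendants\<close>

text \<open>The projection to the original graph; the fibre over \<open>v\<close> consists of
  \<open>v\<close> and its pendants.\<close>

primrec base_of :: "'a pendant_vertex \<Rightarrow> 'a" where
  "base_of (Base v) = v"
| "base_of (Pendant v j) = v"

text \<open>The right-hand condition is what dominating the pendants demands. For
  \<open>r \<ge> 1\<close> it also takes care of the base vertices: if \<open>Base v\<close> is
  outside \<open>D\<close>, its neighbor \<open>Pendant v 1\<close> lies in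
  \<open>D\<close>.\<close>

lemma dominating_set_attach_pendants_iff:
  assumes "r \<ge> 1"
  shows "dominating_set (attach_pendants r G) D \<longleftrightarrow>
    D \<subseteq> pverts (attach_pendants r G) \<and>
    (\<forall>v\<in>pverts G. Base v \<in> D \<or> (\<forall>j\<in>{1..r}. Pendant v j \<in> D))"
    (is "?L \<longleftrightarrow> ?R")
proof
  assume dom: ?L
  \<comment> \<open>Proved for each \<open>j\<close> separately; as \<open>Base v \<in> D\<close>
    does not mention \<open>j\<close>, it can afterwards be pulled out of the quantifier.\<close>
  have "Base v \<in> D \<or> Pendant v j \<in> D" if "v \<in> pverts G" "j \<in> {1..r}" for v j
  proof -
    have "Pendant v j \<in> pverts (attach_pendants r G)"
      using that by (simp add: attach_pendants_def)
    then have "Pendant v j \<in> D \<or> (\<exists>u\<in>D. (Pendant v j, u) \<in> parcs (attach_pendants r G))"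
      using dom by (simp add: dominating_set_def)
    moreover have "u = Base v" if "(Pendant v j, u) \<in> parcs (attach_pendants r G)" for u
      using that by (auto simp: attach_pendants_def)
    ultimately show ?thesis by metis
  qed
  moreover have "D \<subseteq> pverts (attach_pendants r G)"
    using dom by (simp add: dominating_set_def)
  ultimately show ?R by blast
next
  assume R: ?R
  have one: "1 \<in> {1..r}"
    using assms by simp
  have "x \<in> D \<or> (\<exists>u\<in>D. (x, u) \<in> parcs (attach_pendants r G))"
    if "x \<in> pverts (attach_pendants r G)" for x
  proof (cases x)
    case (Base v)
    with that have v: "v \<in> pverts G"
      by (auto simp: attach_pendants_def)
    then have "(Base v, Pendant v 1) \<in> parcs (attach_pendants r G)"
      using one by (auto simp: attach_pendants_def)
    moreover have "Base v \<in> D \<or> Pendant v 1 \<in> D"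
      using R v one by auto
    ultimately show ?thesis
      using Base by auto
  next
    case (Pendant v j)
    with that have v: "v \<in> pverts G" "j \<in> {1..r}"
      by (auto simp: attach_pendants_def)
    then have "(Pendant v j, Base v) \<in> parcs (attach_pendants r G)"
      by (auto simp: attach_pendants_def)
    moreover have "Base v \<in> D \<or> Pendant v j \<in> D"
      using R v by auto
    ultimately show ?thesis
      using Pendant by auto
  qed
  with R show ?L
    by (simp add: dominating_set_def)
qed

section \<open>The fibre map and the domination number\<close>

lemma finite_pverts_attach_pendants:
  assumes "finite (pverts G)"
  shows "finite (pverts (attach_pendants r G))"
proof -
  have "pverts (attach_pendants r G) =
      Base ` pverts G \<union> (\<lambda>(v, j). Pendant v j) ` (pverts G \<times> {1..r})"
    by (auto simp: attach_pendants_def)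
  with assms show ?thesis by simp
qed

lemma finite_dominating_set_attach_pendants:
  assumes "finite (pverts G)" and "dominating_set (attach_pendants r G) D"
  shows "finite D"
proof (rule finite_subset)
  show "D \<subseteq> pverts (attach_pendants r G)"
    using assms(2) by (simp add: dominating_set_def)
qed (rule finite_pverts_attach_pendants[OF assms(1)])

text \<open>Each \<open>v\<close> is hit because \<open>D\<close> contains \<open>Base v\<close> or
  else \<open>Pendant v 1\<close>. The resulting surjection from \<open>D\<close> onto the vertices
  of \<open>G\<close> yields the lower bound on \<open>card D\<close> and, in case of equality,
  injectivity.\<close>

lemma base_of_image_dominating_set:
  assumes r: "r \<ge> 1" and dom: "dominating_set (attach_pendants r G) D"
  shows "base_of ` D = pverts G"
proof
  have "D \<subseteq> pverts (attach_pendants r G)"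
    using dom by (simp add: dominating_set_def)
  then show "base_of ` D \<subseteq> pverts G"
    by (auto simp: attach_pendants_def)
next
  show "pverts G \<subseteq> base_of ` D"
  proof
    fix v assume "v \<in> pverts G"
    moreover have "1 \<in> {1..r}"
      using r by simp
    ultimately have "Base v \<in> D \<or> Pendant v 1 \<in> D"
      using dom by (auto simp: dominating_set_attach_pendants_iff[OF r])
    then show "v \<in> base_of ` D"
      by (auto intro: rev_image_eqI)
  qed
qed

lemma dominating_set_Base_image:
  assumes "r \<ge> 1"
  shows "dominating_set (attach_pendants r G) (Base ` pverts G)"
  unfolding dominating_set_attach_pendants_iff[OF assms]
  by (auto simp: attach_pendants_def)

lemma card_Base_image: "card (Base ` A) = card A"
  by (intro card_image inj_onI) simp

lemma domination_number_attach_pendants: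
  assumes "finite (pverts G)" and "r \<ge> 1"
  shows "domination_number (attach_pendants r G) = card (pverts G)"
  unfolding domination_number_def
proof (rule Least_equality)
  show "\<exists>D. dominating_set (attach_pendants r G) D \<and> card D = card (pverts G)"
    using dominating_set_Base_image[OF assms(2)] card_Base_image by blast
next
  fix k
  assume "\<exists>D. dominating_set (attach_pendants r G) D \<and> card D = k"
  then obtain D where D: "dominating_set (attach_pendants r G) D" "card D = k" by blast
  have "card (base_of ` D) \<le> card D"
    using finite_dominating_set_attach_pendants[OF assms(1) D(1)] by (rule card_image_le)
  then show "card (pverts G) \<le> k"
    using base_of_image_dominating_set[OF assms(2) D(1)] D(2) by simp
qed

text \<open>A surjection between finite sets of equal size is injective, so a minimum dominating set
  has only one element in each fibre.\<close>

lemma inj_on_base_of_minimum_dominating_set: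
  assumes "finite (pverts G)" and "r \<ge> 1"
    and "minimum_dominating_set (attach_pendants r G) D"
  shows "inj_on base_of D"
proof (rule eq_card_imp_inj_on)
  have dom: "dominating_set (attach_pendants r G) D"
    and card: "card D = card (pverts G)"
    using assms by (simp_all add: minimum_dominating_set_def domination_number_attach_pendants)
  show "card (base_of ` D) = card D"
    using base_of_image_dominating_set[OF assms(2) dom] card by simp
  show "finite D"
    using assms(1) dom by (rule finite_dominating_set_attach_pendants)
qed

section \<open>At least two pendants per vertex\<close>

lemma minimum_dominating_sets_two_pendants:
  assumes fin: "finite (pverts G)" and r: "r \<ge> 2"
  shows "{D. minimum_dominating_set (attach_pendants r G) D} = {Base ` pverts G}"
proof -
  have r1: "r \<ge> 1"
    using r by simp
  have "D = Base ` pverts G" if D: "minimum_dominating_set (attach_pendants r G) D" for D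
  proof -
    have dom: "dominating_set (attach_pendants r G) D"
      and card: "card D = card (pverts G)"
      using D fin r1 by (simp_all add: minimum_dominating_set_def domination_number_attach_pendants)
    have "Base v \<in> D" if v: "v \<in> pverts G" for v
    proof (rule ccontr)
      assume "Base v \<notin> D"
      then have "\<forall>j\<in>{1..r}. Pendant v j \<in> D"
        using dom v by (auto simp: dominating_set_attach_pendants_iff[OF r1])
      \<comment> \<open>Here \<open>r \<ge> 2\<close> enters: two distinct elements of
        \<open>D\<close> in one fibre contradict injectivity of \<open>base_of\<close>.\<close>
      then have "Pendant v 1 \<in> D" "Pendant v 2 \<in> D"
        using r by auto
      then show False
        using inj_onD[OF inj_on_base_of_minimum_dominating_set[OF fin r1 D],
            of "Pendant v 1" "Pendant v 2"] by simp
    qed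
    \<comment> \<open>An inclusion of finite sets of equal size is an equality.\<close>
    then have "Base ` pverts G \<subseteq> D" by blast
    then have "Base ` pverts G = D"
      using finite_dominating_set_attach_pendants[OF fin dom] card
      by (intro card_subset_eq) (simp_all add: card_Base_image)
    then show ?thesis by (rule sym)
  qed
  moreover have "minimum_dominating_set (attach_pendants r G) (Base ` pverts G)"
    using dominating_set_Base_image[OF r1] fin r1
    by (simp add: minimum_dominating_set_def domination_number_attach_pendants card_Base_image)
  ultimately show ?thesis by blast
qed

section \<open>Exactly one pendant per vertex\<close>

text \<open>A choice function is a section of \<open>base_of\<close>. Hence it is injective, and its
  image determines it on \<open>V\<close>.\<close>

lemma base_of_choice:
  assumes "\<forall>v\<in>V. f v \<in> {Base v, Pendant v 1}" and "v \<in> V"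
  shows "base_of (f v) = v"
  using assms by force

lemma minimum_dominating_sets_one_pendant:
  assumes fin: "finite (pverts G)"
  shows "{D. minimum_dominating_set (attach_pendants 1 G) D} =
    {f ` pverts G | f. \<forall>v\<in>pverts G. f v \<in> {Base v, Pendant v 1}}"
proof (intro equalityI subsetI)
  fix D assume "D \<in> {D. minimum_dominating_set (attach_pendants 1 G) D}"
  then have D: "minimum_dominating_set (attach_pendants 1 G) D" by simp
  then have dom: "dominating_set (attach_pendants 1 G) D"
    by (simp add: minimum_dominating_set_def)
  then have sub: "D \<subseteq> pverts (attach_pendants 1 G)"
    by (simp add: dominating_set_def)
  \<comment> \<open>The choice function recovered from \<open>D\<close>: it sends \<open>v\<close>
    to the only element of \<open>D\<close> in the fibre over \<open>v\<close>.\<close>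
  define f where "f = inv_into D base_of"
  have img: "base_of ` D = pverts G"
    by (rule base_of_image_dominating_set[OF order_refl dom])
  have inj: "inj_on base_of D"
    by (rule inj_on_base_of_minimum_dominating_set[OF fin order_refl D])
  have "f v \<in> {Base v, Pendant v 1}" if "v \<in> pverts G" for v
  proof -
    have "v \<in> base_of ` D"
      using that img by simp
    then have "f v \<in> D" "base_of (f v) = v"
      unfolding f_def by (rule inv_into_into, rule f_inv_into_f)
    \<comment> \<open>For \<open>r = 1\<close> the fibre over \<open>v\<close> is just
      \<open>Base v\<close> and \<open>Pendant v 1\<close>.\<close>
    with sub show ?thesis
      by (auto simp: attach_pendants_def)
  qed
  moreover have "D = f ` pverts G"
    using inv_into_image_cancel[OF inj subset_refl] img by (simp add: f_def)
  ultimately show "D \<in> {f ` pverts G | f. \<forall>v\<in>pverts G. f v \<in> {Base v, Pendant v 1}}"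
    by blast
next
  fix D assume "D \<in> {f ` pverts G | f. \<forall>v\<in>pverts G. f v \<in> {Base v, Pendant v 1}}"
  then obtain f where f: "\<forall>v\<in>pverts G. f v \<in> {Base v, Pendant v 1}" and D: "D = f ` pverts G"
    by blast
  have "inj_on f (pverts G)"
    by (rule inj_on_inverseI[of _ base_of]) (rule base_of_choice[OF f])
  then have "card D = card (pverts G)"
    unfolding D by (rule card_image)
  moreover have "dominating_set (attach_pendants 1 G) D"
    unfolding dominating_set_attach_pendants_iff[OF order_refl]
  proof
    show "D \<subseteq> pverts (attach_pendants 1 G)"
      using f by (fastforce simp: D attach_pendants_def)
    show "\<forall>v\<in>pverts G. Base v \<in> D \<or> (\<forall>j\<in>{1..1}. Pendant v j \<in> D)"
    proof
      fix v assume "v \<in> pverts G"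
      then have "f v \<in> D" "f v = Base v \<or> f v = Pendant v 1"
        using f D by auto
      then show "Base v \<in> D \<or> (\<forall>j\<in>{1..1}. Pendant v j \<in> D)" by auto
    qed
  qed
  ultimately show "D \<in> {D. minimum_dominating_set (attach_pendants 1 G) D}"
    using fin by (simp add: minimum_dominating_set_def domination_number_attach_pendants)
qed

text \<open>There are two options at each vertex, and different choices give different sets, since
  the element of the set over \<open>v\<close> reveals the choice at \<open>v\<close>.\<close>

lemma card_choice_images:
  assumes "finite V"
  shows "card {f ` V | f. \<forall>v\<in>V. f v \<in> {Base v, Pendant v 1}} = 2 ^ card V"
proof -
  \<comment> \<open>Total functions that differ only outside \<open>V\<close> have the same image.
    In \<open>PiE\<close> they are fixed to \<open>undefined\<close> there, so that each set comes
    from one function only.\<close>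
  let ?F = "PiE V (\<lambda>v. {Base v, Pendant v 1})"
  have "{f ` V | f. \<forall>v\<in>V. f v \<in> {Base v, Pendant v 1}} = (\<lambda>f. f ` V) ` ?F"
  proof (intro equalityI subsetI)
    fix D assume "D \<in> {f ` V | f. \<forall>v\<in>V. f v \<in> {Base v, Pendant v 1}}"
    then obtain f where f: "\<forall>v\<in>V. f v \<in> {Base v, Pendant v 1}" and D: "D = f ` V"
      by blast
    have "restrict f V \<in> ?F"
      using f by (intro restrict_PiE_iff[THEN iffD2])
    moreover have "D = restrict f V ` V"
      by (simp add: D)
    ultimately show "D \<in> (\<lambda>f. f ` V) ` ?F" by blast
  next
    fix D assume "D \<in> (\<lambda>f. f ` V) ` ?F"
    then show "D \<in> {f ` V | f. \<forall>v\<in>V. f v \<in> {Base v, Pendant v 1}}"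
      by (blast dest: PiE_mem)
  qed
  moreover have "inj_on (\<lambda>f. f ` V) ?F"
  proof (rule inj_onI)
    fix f g assume f: "f \<in> ?F" and g: "g \<in> ?F" and eq: "f ` V = g ` V"
    have f': "\<forall>v\<in>V. f v \<in> {Base v, Pendant v 1}" and g': "\<forall>v\<in>V. g v \<in> {Base v, Pendant v 1}"
      using f g PiE_mem by fast+
    show "f = g"
    proof (rule PiE_ext[OF f g])
      fix v assume v: "v \<in> V"
      \<comment> \<open>Equality of the images only matches \<open>f v\<close> with some
        \<open>g w\<close>; applying \<open>base_of\<close> to both sides forces
        \<open>v = w\<close>.\<close>
      then obtain w where w: "w \<in> V" "f v = g w"
        using eq by blast
      then have "v = w"
        using base_of_choice[OF f' v] base_of_choice[OF g' w(1)] by simp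
      with w show "f v = g v" by simp
    qed
  qed
  moreover have "card ?F = 2 ^ card V"
    using assms by (simp add: card_PiE numeral_2_eq_2)
  ultimately show ?thesis
    by (simp add: card_image)
qed

section \<open>The path with pendants\<close>

theorem theorem3:
  fixes n r :: nat and G :: "nat pendant_vertex pair_pre_digraph"
  assumes "n \<ge> 1" and "r \<ge> 1" and "G = attach_pendants r (path_graph n)"
  shows "domination_number G = n
    \<and> dominion G = (if r = 1 then 2 ^ n else 1)
    \<and> (r \<ge> 2 \<longrightarrow> {D. minimum_dominating_set G D} = {Base ` {1..n}})
    \<and> (r = 1 \<longrightarrow> {D. minimum_dominating_set G D}
          = {f ` {1..n} | f. \<forall>i\<in>{1..n}. f i \<in> {Base i, Pendant i 1}})"
proof -
  have V: "pverts (path_graph n) = {1..n}"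
    by (simp add: path_graph_def)
  then have fin: "finite (pverts (path_graph n))" by simp
  have num: "domination_number G = n"
    using domination_number_attach_pendants[OF fin assms(2)] V assms(3) by simp
  have two: "{D. minimum_dominating_set G D} = {Base ` {1..n}}" if "r \<ge> 2"
    using minimum_dominating_sets_two_pendants[OF fin that] V assms(3) by simp
  have one: "{D. minimum_dominating_set G D}
      = {f ` {1..n} | f. \<forall>i\<in>{1..n}. f i \<in> {Base i, Pendant i 1}}" if "r = 1"
    using minimum_dominating_sets_one_pendant[OF fin] unfolding V assms(3) that .
  have "dominion G = (if r = 1 then 2 ^ n else 1)"
  proof (cases "r = 1")
    case True
    then show ?thesis
      unfolding dominion_def one[OF True] card_choice_images[OF finite_atLeastAtMost] by simp
  next
    case False
    then have "r \<ge> 2"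
      using assms(2) by simp
    with False show ?thesis
      by (simp add: dominion_def two)
  qed
  with num one two show ?thesis by blast
qed

end
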